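(* Let $N\ge 1$ be an integer and $x,y\in[0,1]$, and put $u=\frac12(x+y)$. Let $X_1,\dots,X_N$ and $Y_1,\dots,Y_N$ be the dither computing representations of $x$ and of $y$, both with the identity permutation (defined in the context). Let $s_i=1$ for $i$ odd and $s_i=0$ for $i$ even, and let the control sequence $(W_i)_{i=1}^N$ be, with probability $\frac12$, equal to $(s_i)_{i=1}^N$ and, with probability $\frac12$, equal to $(1-s_i)_{i=1}^N$. Define $U_i=W_iX_i+(1-W_i)Y_i$ and $U_s=\frac1N\sum_{i=1}^N U_i$. Then $E(U_s)=u$ (that is, the bias $E(U_s)-u$ is $0$) and $\mathrm{Var}(U_s)=O\left(\frac1{N^2}\right)$ as $N\to\infty$. Consequently, if $x,y$ are samples of independent random variables $X,Y$ with values in $[0,1]$, the expected mean squared error of estimating $u$ by $U_s$ satisfies $L=O\left(\frac1{N^2}\right)$ as $N\to\infty$.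
   Context: Dither computing representation of $x\in[0,1]$ with $N$ pulses and the identity permutation: $X_1,\dots,X_N$ are independent Bernoulli ($\{0,1\}$-valued) random variables with success probabilities as follows. If $x\in[0,\frac12]$: let $n=\lfloor Nx\rfloor$, $r=x-\frac nN$, $\delta=\frac{Nr}{N-n}$. Then $P(X_i=1)=1$ for $1\le i\le n$ and $P(X_i=1)=\delta$ for $n+1\le i\le N$. If $x\in(\frac12,1]$: let $n=\lceil Nx\rceil$, $r=\frac nN-x$, $\delta=\frac{rN}{n}$. Then $P(X_i=1)=1-\delta$ for $1\le i\le n$ and $P(X_i=1)=0$ for $n+1\le i\le N$. The variables $Y_1,\dots,Y_N$ are defined in the same way from $y$. All the $X_i$ and $Y_j$ are mutually independent, and the control sequence $(W_i)$ is independent of all the $X_i$ and $Y_j$ (the $W_i$ are not independent of each other). The expected mean squared error is $L=E_{X,Y}(L_{x,y})$, where $L_{x,y}=E\big((U_s-u)^2\mid X=x,\,Y=y\big)$ and $E_{X,Y}$ is the expectation over the distribution of $(X,Y)$. *)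

theory Defs
  imports "HOL-Probability.Probability" "HOL-Library.Landau_Symbols"
begin

definition dither_prob :: "nat \<Rightarrow> real \<Rightarrow> nat \<Rightarrow> real" where
  "dither_prob N x i =
     (if x \<le> 1/2 then
        let n = \<lfloor>real N * x\<rfloor>;
            r = x - of_int n / real N;
            \<delta> = real N * r / (real N - of_int n)
        in if int i \<le> n then 1 else \<delta>
      else
        let n = \<lceil>real N * x\<rceil>;
            r = of_int n / real N - x;
            \<delta> = r * real N / of_int n
        in if int i \<le> n then 1 - \<delta> else 0)"

definition alternating :: "nat \<Rightarrow> real" where
  "alternating i = (if odd i then 1 else 0)"

text \<open>
  The pulses of \<open>x\<close> and of \<open>y\<close> are \<open>A 1, \<dots>, A N\<close> and \<open>B 1, \<dots>, B N\<close>; the names \<open>X\<close> and \<open>Y\<close>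
  are kept for the random variables from which \<open>x\<close> and \<open>y\<close> are sampled. Mutual independence of all
  pulses is independence of one family indexed by the disjoint union of two copies of \<open>{1..N}\<close>.
  The control sequence is independent of all pulses in the sense that the generated \<open>\<sigma>\<close>-algebras
  are independent (\<open>indep_var\<close> would need both tuples to have the same type).
  Only the values of \<open>A\<close>, \<open>B\<close>, \<open>W\<close> at indices in \<open>{1..N}\<close> are constrained.
\<close>

locale dither_computing = prob_space M for M :: "'a measure" +
  fixes N :: nat and x y :: real and A B W :: "nat \<Rightarrow> 'a \<Rightarrow> real"
  assumes A_bit: "\<And>i \<omega>. i \<in> {1..N} \<Longrightarrow> \<omega> \<in> space M \<Longrightarrow> A i \<omega> \<in> {0, 1}"
    and B_bit: "\<And>i \<omega>. i \<in> {1..N} \<Longrightarrow> \<omega> \<in> space M \<Longrightarrow> B i \<omega> \<in> {0, 1}"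
    and A_prob: "\<And>i. i \<in> {1..N} \<Longrightarrow> prob {\<omega> \<in> space M. A i \<omega> = 1} = dither_prob N x i"
    and B_prob: "\<And>i. i \<in> {1..N} \<Longrightarrow> prob {\<omega> \<in> space M. B i \<omega> = 1} = dither_prob N y i"
    and pulses_indep: "indep_vars (\<lambda>_. borel) (case_sum A B) ({1..N} <+> {1..N})"
    and W_prob: "prob {\<omega> \<in> space M. \<forall>i\<in>{1..N}. W i \<omega> = alternating i} = 1/2"
    and W_prob': "prob {\<omega> \<in> space M. \<forall>i\<in>{1..N}. W i \<omega> = 1 - alternating i} = 1/2"
    and W_rv: "\<And>i. i \<in> {1..N} \<Longrightarrow> random_variable borel (W i)"
    and W_indep: "indep_set
          (sets (vimage_algebra (space M) (\<lambda>\<omega>. \<lambda>i\<in>{1..N}. W i \<omega>) (PiM {1..N} (\<lambda>_. borel))))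
          (sets (vimage_algebra (space M) (\<lambda>\<omega>. \<lambda>k\<in>{1..N} <+> {1..N}. case_sum A B k \<omega>)
            (PiM ({1..N} <+> {1..N}) (\<lambda>_. borel))))"

definition U_avg ::
    "nat \<Rightarrow> (nat \<Rightarrow> 'a \<Rightarrow> real) \<Rightarrow> (nat \<Rightarrow> 'a \<Rightarrow> real) \<Rightarrow> (nat \<Rightarrow> 'a \<Rightarrow> real) \<Rightarrow> 'a \<Rightarrow> real" where
  "U_avg N A B W \<omega> = (1 / real N) * (\<Sum>i = 1..N. W i \<omega> * A i \<omega> + (1 - W i \<omega>) * B i \<omega>)"

text \<open>
  The conditional mean squared error \<open>L\<^sub>x\<^sub>,\<^sub>y\<close>. Here \<open>M\<close> carries the pulses generated for the fixed
  sample \<open>(x, y)\<close>, so conditioning on \<open>X = x, Y = y\<close> is taking the expectation in \<open>M\<close>.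
\<close>

definition cond_mse ::
    "'a measure \<Rightarrow> nat \<Rightarrow> real \<Rightarrow> real \<Rightarrow>
      (nat \<Rightarrow> 'a \<Rightarrow> real) \<Rightarrow> (nat \<Rightarrow> 'a \<Rightarrow> real) \<Rightarrow> (nat \<Rightarrow> 'a \<Rightarrow> real) \<Rightarrow> real" where
  "cond_mse M N x y A B W =
     prob_space.expectation M (\<lambda>\<omega>. (U_avg N A B W \<omega> - (x + y) / 2)\<^sup>2)"

end

theory Submission imports Defs
begin

text \<open>
  Condition on the control sequence: \<open>U_s\<close> is then an average of independent pulses, each taken
  from \<open>x\<close> or from \<open>y\<close> according to the parity of its index. Its variance is at most \<open>2 / N\<^sup>2\<close>, because
  the non-deterministic pulses of each number have variances summing to at most \<open>1\<close>. Its bias is an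
  alternating sum of the success probabilities divided by \<open>2N\<close>; these are nonincreasing and lie in
  \<open>[0, 1]\<close>, so it is at most \<open>1 / (2N)\<close> in absolute value. The two biases cancel in the mean.
  Moreover the mean squared error is an explicit function of the success probabilities, hence a
  measurable function of \<open>(x, y)\<close>.
\<close>

section \<open>Success probabilities of a dither representation\<close>

text \<open>Both branches of the definition have the same two-level shape, with one level
  deterministic (\<open>a = 1\<close> or \<open>b = 0\<close>). The pulses of the other level
  deviate by \<open>d\<close> each, and these deviations add up to the distance from
  \<open>N * x\<close> to the rounded integer \<open>m\<close>, which is less than 1. This is why
  the total variance stays bounded independently of \<open>N\<close>.\<close>

lemma dither_prob_step:
  assumes "N \<ge> 1" and "x \<in> {0..1}"
  obtains m a b where "m \<le> N" "0 \<le> b" "b \<le> a" "a \<le> 1"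
    and "\<And>i. dither_prob N x i = (if i \<le> m then a else b)"
    and "real m * a + (real N - real m) * b = real N * x"
    and "real m * (a * (1 - a)) + (real N - real m) * (b * (1 - b)) \<le> 1"
proof (cases "x \<le> 1/2")
  case True
  define m where "m = nat \<lfloor>real N * x\<rfloor>"
  have fl: "\<lfloor>real N * x\<rfloor> = int m"
    using assms by (simp add: m_def)
  have m: "real m \<le> real N * x" "real N * x < real m + 1"
    using fl by linarith+
  have "real N * x \<le> real N * (1/2)"
    using True by (intro mult_left_mono) auto
  \<comment> \<open>Here \<open>x \<le> 1/2\<close> matters: it keeps \<open>N * x\<close> strictly
    below \<open>N\<close>, so the divisor \<open>N - m\<close> of \<open>d\<close> is
    positive.\<close>
  with m(1) assms(1) have mN: "m < N" by linarith
  define d where "d = (real N * x - real m) / (real N - real m)"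
  have d: "(real N - real m) * d = real N * x - real m"
    using mN by (simp add: d_def)
  have d0: "0 \<le> d" using m mN by (simp add: d_def)
  have "real N * x - real m \<le> real N - real m"
    using m mN by linarith
  then have d1: "d \<le> 1" using mN by (simp add: d_def)
  have "(real N - real m) * (d * (1 - d)) = (real N * x - real m) * (1 - d)"
    by (simp flip: d)
  \<comment> \<open>The first factor is the fractional part of \<open>N * x\<close>, so both factors
    lie in the unit interval.\<close>
  also have "\<dots> \<le> 1"
    using m d0 d1 by (intro mult_le_one) auto
  finally have "real m * (1 * (1 - 1)) + (real N - real m) * (d * (1 - d)) \<le> 1"
    by simp
  moreover have "dither_prob N x i = (if i \<le> m then 1 else d)" for i
    using True assms(1) by (simp add: dither_prob_def Let_def fl d_def right_diff_distrib)
  moreover have "real m * 1 + (real N - real m) * d = real N * x"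
    using d by simp
  ultimately show thesis
    using that[of m d 1] mN d0 d1 by simp
next
  case False
  define m where "m = nat \<lceil>real N * x\<rceil>"
  have "0 < real N * x" using False assms(1) by simp
  then have cl: "\<lceil>real N * x\<rceil> = int m"
    by (simp add: m_def)
  have m: "real N * x \<le> real m" "real m < real N * x + 1"
    using cl by linarith+
  \<comment> \<open>Since \<open>x > 1/2\<close>, the ceiling is not 0, and it can serve as the
    divisor of \<open>d\<close>.\<close>
  have m0: "0 < m" using m(1) \<open>0 < real N * x\<close> by linarith
  have "real N * x \<le> real N * 1"
    using assms(2) by (intro mult_left_mono) auto
  with m have mN: "m \<le> N" by linarith
  define d where "d = (real m - real N * x) / real m"
  have d: "real m * d = real m - real N * x"
    using m0 by (simp add: d_def)
  have d0: "0 \<le> d" using m m0 by (simp add: d_def)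
  have d1: "d \<le> 1" using m0 \<open>0 < real N * x\<close> by (simp add: d_def)
  have "real m * (d * (1 - d)) = (real m - real N * x) * (1 - d)"
    by (simp flip: d)
  also have "\<dots> \<le> 1"
    using m d0 d1 by (intro mult_le_one) auto
  finally have "real m * ((1 - d) * (1 - (1 - d))) + (real N - real m) * (0 * (1 - 0)) \<le> 1"
    by (simp add: mult.commute)
  moreover have "dither_prob N x i = (if i \<le> m then 1 - d else 0)" for i
    using False assms(1) by (simp add: dither_prob_def Let_def cl d_def left_diff_distrib)
  moreover have "real m * (1 - d) + (real N - real m) * 0 = real N * x"
    using d by (simp add: right_diff_distrib)
  ultimately show thesis
    using that[of m 0 "1 - d"] mN d0 d1 by simp
qed

lemma sum_step_function:
  fixes a b :: real
  assumes "m \<le> N"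
  shows "(\<Sum>i = 1..N. if i \<le> m then a else b) = real m * a + (real N - real m) * b"
  using assms by (induction N rule: dec_induct) (simp_all add: algebra_simps)

text \<open>Apart from measurability in \<open>x\<close>, these are the only properties of the
  success probabilities used later.\<close>

lemma
  assumes "N \<ge> 1" and "x \<in> {0..1}"
  shows dither_prob_nonneg: "0 \<le> dither_prob N x i"
    and dither_prob_le_1: "dither_prob N x i \<le> 1"
    and antimono_dither_prob: "antimono (dither_prob N x)"
    and sum_dither_prob: "(\<Sum>i = 1..N. dither_prob N x i) = real N * x"
    and sum_dither_variance: "(\<Sum>i = 1..N. dither_prob N x i * (1 - dither_prob N x i)) \<le> 1"
proof -
  obtain m a b where m: "m \<le> N" and ab: "0 \<le> b" "b \<le> a" "a \<le> 1"
    and p: "\<And>i. dither_prob N x i = (if i \<le> m then a else b)"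
    and s: "real m * a + (real N - real m) * b = real N * x"
    and v: "real m * (a * (1 - a)) + (real N - real m) * (b * (1 - b)) \<le> 1"
    by (rule dither_prob_step[OF assms]) (rule that)
  show "0 \<le> dither_prob N x i" "dither_prob N x i \<le> 1"
    using ab by (auto simp: p)
  show "antimono (dither_prob N x)"
    using ab by (auto simp: p intro!: antimonoI)
  show "(\<Sum>i = 1..N. dither_prob N x i) = real N * x"
    by (simp only: p sum_step_function[OF m] s)
  have "dither_prob N x i * (1 - dither_prob N x i) = (if i \<le> m then a * (1 - a) else b * (1 - b))" for i
    by (simp add: p)
  then show "(\<Sum>i = 1..N. dither_prob N x i * (1 - dither_prob N x i)) \<le> 1"
    using v by (simp only: sum_step_function[OF m])
qed

text \<open>Needed for integrating the error over the random samples \<open>X\<close> and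
  \<open>Y\<close>.\<close>

lemma borel_measurable_dither_prob:
  "(\<lambda>x. dither_prob N x i) \<in> borel_measurable borel"
  unfolding dither_prob_def Let_def by measurable

section \<open>Alternating sums and sums over one parity\<close>

lemma alternating_sum_antimono:
  fixes p :: "nat \<Rightarrow> real"
  assumes "antimono p" and "\<And>i. 0 \<le> p i" and "\<And>i. p i \<le> 1"
  shows "(\<Sum>i = 1..n. if odd i then p i else - p i) \<in> {0..1}"
proof -
  \<comment> \<open>The induction keeps a reserve of \<open>p n\<close> on the side towards which
    the next term moves. The next term has size \<open>p (Suc n)\<close>, at most
    \<open>p n\<close>, and so cannot leave the interval. For \<open>n = 0\<close> the reserve is
    \<open>p 0 \<le> 1\<close>.\<close>
  have "if odd n then p n \<le> (\<Sum>i = 1..n. if odd i then p i else - p i) \<and>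
          (\<Sum>i = 1..n. if odd i then p i else - p i) \<le> 1
        else 0 \<le> (\<Sum>i = 1..n. if odd i then p i else - p i) \<and>
          (\<Sum>i = 1..n. if odd i then p i else - p i) \<le> 1 - p n"
  proof (induction n)
    case 0
    show ?case using assms(3)[of 0] by simp
  next
    case (Suc n)
    have "p (Suc n) \<le> p n" by (rule antimonoD[OF assms(1)]) simp
    then show ?case using Suc by (auto split: if_splits)
  qed
  then show ?thesis
    using assms(2)[of n] by (auto split: if_splits)
qed

text \<open>Each selected term counts twice and each other term cancels. This separates the full
  sum, known exactly, from a signed sum, which for parities is the alternating one.\<close>

lemma sum_parity:
  fixes p :: "nat \<Rightarrow> real"
  shows "(\<Sum>i | i \<in> {1..n} \<and> R i. p i) =
    ((\<Sum>i = 1..n. p i) + (\<Sum>i = 1..n. if R i then p i else - p i)) / 2"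
proof -
  have "(\<Sum>i | i \<in> {1..n} \<and> R i. p i) = (\<Sum>i = 1..n. if R i then p i else 0)"
    by (rule sum.inter_filter) simp
  also have "\<dots> = (\<Sum>i = 1..n. (p i + (if R i then p i else - p i)) / 2)"
    by (intro sum.cong) auto
  finally show ?thesis
    by (simp add: sum.distrib flip: sum_divide_distrib)
qed

section \<open>Product rule for independent algebras, and moments of Bernoulli sums\<close>

context prob_space
begin

text \<open>The indicator of \<open>E\<close> and the variable \<open>Y\<close> generate algebras
  contained in \<open>F\<close> and \<open>G\<close>, so they inherit independence. Later
  \<open>F\<close> is generated by the control sequence and \<open>G\<close> by the pulses.\<close>

lemma expectation_indicator_mult_indep:
  fixes Y :: "'a \<Rightarrow> real"
  assumes indep: "indep_set (sets F) (sets G)"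
    and space: "space F = space M" "space G = space M"
    and E: "E \<in> sets F" and Y: "Y \<in> borel_measurable G" and int: "integrable M Y"
  shows "integrable M (\<lambda>\<omega>. indicator E \<omega> * Y \<omega>)"
    and "expectation (\<lambda>\<omega>. indicator E \<omega> * Y \<omega>) = prob E * expectation Y"
proof -
  have EM: "E \<in> events"
    using indep_setD_ev1[OF indep] E by auto
  have vimage: "sigma_sets (space M) {Z -` S \<inter> space M | S. S \<in> sets borel} \<subseteq> sets H"
    if "Z \<in> borel_measurable H" "space H = space M" for Z :: "'a \<Rightarrow> real" and H
    unfolding that(2)[symmetric] using that(1)
    by (intro sets.sigma_sets_subset) (auto intro: measurable_sets)
  have "indep_var borel (indicator E :: 'a \<Rightarrow> real) borel Y"
    unfolding indep_var_eq indep_set_def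
  proof (intro conjI)
    show "indep_sets
        (case_bool (sigma_sets (space M) {(indicator E :: 'a \<Rightarrow> real) -` S \<inter> space M | S. S \<in> sets borel})
          (sigma_sets (space M) {Y -` S \<inter> space M | S. S \<in> sets borel})) UNIV"
      using indep[unfolded indep_set_def]
    proof (rule indep_sets_mono_sets)
      fix i
      show "case_bool (sigma_sets (space M) {(indicator E :: 'a \<Rightarrow> real) -` S \<inter> space M | S. S \<in> sets borel})
          (sigma_sets (space M) {Y -` S \<inter> space M | S. S \<in> sets borel}) i
        \<subseteq> case_bool (sets F) (sets G) i"
        using vimage[of "indicator E" F] vimage[of Y G] space E Y by (cases i) auto
    qed
  qed (use EM int in auto)
  moreover have "integrable M (indicator E :: 'a \<Rightarrow> real)"
    using EM by (intro integrable_real_indicator) (simp_all add: emeasure_eq_measure)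
  ultimately show "integrable M (\<lambda>\<omega>. indicator E \<omega> * Y \<omega>)"
    and "expectation (\<lambda>\<omega>. indicator E \<omega> * Y \<omega>) = prob E * expectation Y"
    using indep_var_integrable[of "indicator E" Y] indep_var_lebesgue_integral[of "indicator E" Y]
      int EM by (simp_all add: Int_absorb2 sets.sets_into_space)
qed

lemma
  fixes Z :: "'a \<Rightarrow> real"
  assumes "random_variable borel Z" and bit: "\<And>\<omega>. \<omega> \<in> space M \<Longrightarrow> Z \<omega> \<in> {0, 1}"
  shows integrable_bit: "integrable M Z"
    and expectation_bit: "expectation Z = prob {\<omega> \<in> space M. Z \<omega> = 1}"
proof -
  note [measurable] = assms(1)
  show "integrable M Z"
    using bit by (intro integrable_const_bound[where B = 1]) fastforce+
  have "expectation Z = expectation (indicator {\<omega> \<in> space M. Z \<omega> = 1})"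
    using bit by (intro Bochner_Integration.integral_cong) (fastforce simp: indicator_def)+
  then show "expectation Z = prob {\<omega> \<in> space M. Z \<omega> = 1}"
    by (simp add: Int_absorb2)
qed

text \<open>Bias-variance decomposition. Squaring the sum gives products of pairs: a diagonal
  product collapses because a bit equals its square, and any other product factors by
  independence.\<close>

lemma indep_bits_mse:
  fixes Z :: "'i \<Rightarrow> 'a \<Rightarrow> real" and c u :: real
  assumes fin: "finite J" and indep: "indep_vars (\<lambda>_. borel) Z J"
    and bit: "\<And>k \<omega>. k \<in> J \<Longrightarrow> \<omega> \<in> space M \<Longrightarrow> Z k \<omega> \<in> {0, 1}"
    and p: "\<And>k. k \<in> J \<Longrightarrow> prob {\<omega> \<in> space M. Z k \<omega> = 1} = p k"
  shows "integrable M (\<lambda>\<omega>. c * (\<Sum>k\<in>J. Z k \<omega>))"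
    and "expectation (\<lambda>\<omega>. c * (\<Sum>k\<in>J. Z k \<omega>)) = c * (\<Sum>k\<in>J. p k)"
    and "integrable M (\<lambda>\<omega>. (c * (\<Sum>k\<in>J. Z k \<omega>) - u)\<^sup>2)"
    and "expectation (\<lambda>\<omega>. (c * (\<Sum>k\<in>J. Z k \<omega>) - u)\<^sup>2)
      = c\<^sup>2 * (\<Sum>k\<in>J. p k * (1 - p k)) + (c * (\<Sum>k\<in>J. p k) - u)\<^sup>2"
proof -
  have rv: "random_variable borel (Z k)" if "k \<in> J" for k
    using indep that by (auto simp: indep_vars_def)
  have int [simp]: "integrable M (Z k)" if "k \<in> J" for k
    using integrable_bit[OF rv bit] that by blast
  have ex [simp]: "expectation (Z k) = p k" if "k \<in> J" for k
    using expectation_bit[OF rv bit] p that by metis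
  have prod: "integrable M (\<lambda>\<omega>. Z k \<omega> * Z l \<omega>) \<and>
      expectation (\<lambda>\<omega>. Z k \<omega> * Z l \<omega>) = (if k = l then p k else p k * p l)"
    if "k \<in> J" "l \<in> J" for k l
  proof (cases "k = l")
    case True
    have "Z k \<omega> * Z k \<omega> = Z k \<omega>" if "\<omega> \<in> space M" for \<omega>
      using bit[OF \<open>k \<in> J\<close> that] by auto
    then have "integrable M (\<lambda>\<omega>. Z k \<omega> * Z k \<omega>) = integrable M (Z k)"
      and "expectation (\<lambda>\<omega>. Z k \<omega> * Z k \<omega>) = expectation (Z k)"
      by (auto intro!: Bochner_Integration.integrable_cong Bochner_Integration.integral_cong)
    then show ?thesis using True that by simp
  next
    case False
    have "indep_vars (\<lambda>_. borel) Z {k, l}"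
      using indep by (rule indep_vars_subset) (use that in auto)
    moreover have "integrable M (Z i)" if "i \<in> {k, l}" for i
      using int \<open>k \<in> J\<close> \<open>l \<in> J\<close> that by auto
    ultimately show ?thesis
      using indep_vars_integrable[of "{k, l}" Z] indep_vars_lebesgue_integral[of "{k, l}" Z] that False
      by simp
  qed
  define S where "S \<omega> = (\<Sum>k\<in>J. Z k \<omega>)" for \<omega>
  define m where "m = (\<Sum>k\<in>J. p k)"
  have S: "integrable M S" "expectation S = m"
    unfolding S_def m_def by (simp_all add: Bochner_Integration.integral_sum)
  have SS: "(S \<omega>)\<^sup>2 = (\<Sum>k\<in>J. \<Sum>l\<in>J. Z k \<omega> * Z l \<omega>)" for \<omega>
    by (simp add: S_def power2_eq_square sum_product)
  have intSS: "integrable M (\<lambda>\<omega>. (S \<omega>)\<^sup>2)"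
    unfolding SS using prod by (intro Bochner_Integration.integrable_sum) blast
  have "expectation (\<lambda>\<omega>. (S \<omega>)\<^sup>2) = (\<Sum>k\<in>J. \<Sum>l\<in>J. if k = l then p k else p k * p l)"
    unfolding SS using prod by (simp add: Bochner_Integration.integral_sum)
  \<comment> \<open>Writing the diagonal entry \<open>p k\<close> as
    \<open>p k * (1 - p k) + p k * p k\<close> leaves the variances plus a complete double sum,
    which is \<open>m\<close> squared.\<close>
  also have "\<dots> = (\<Sum>k\<in>J. \<Sum>l\<in>J. (if k = l then p k * (1 - p k) else 0) + p k * p l)"
    by (intro sum.cong) (auto simp: algebra_simps)
  also have "\<dots> = (\<Sum>k\<in>J. p k * (1 - p k)) + m\<^sup>2"
    using fin by (simp add: sum.distrib m_def power2_eq_square sum_product)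
  finally have exSS: "expectation (\<lambda>\<omega>. (S \<omega>)\<^sup>2) = (\<Sum>k\<in>J. p k * (1 - p k)) + m\<^sup>2" .
  have expand: "(c * S \<omega> - u)\<^sup>2 = c\<^sup>2 * (S \<omega>)\<^sup>2 - 2 * c * u * S \<omega> + u\<^sup>2" for \<omega>
    by (simp add: power2_eq_square algebra_simps)
  show "integrable M (\<lambda>\<omega>. c * (\<Sum>k\<in>J. Z k \<omega>))"
    and "expectation (\<lambda>\<omega>. c * (\<Sum>k\<in>J. Z k \<omega>)) = c * (\<Sum>k\<in>J. p k)"
    using S unfolding S_def m_def by simp_all
  have "integrable M (\<lambda>\<omega>. (c * S \<omega> - u)\<^sup>2)"
    unfolding expand using S intSS by simp
  then show "integrable M (\<lambda>\<omega>. (c * (\<Sum>k\<in>J. Z k \<omega>) - u)\<^sup>2)"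
    unfolding S_def .
  have "expectation (\<lambda>\<omega>. (c * S \<omega> - u)\<^sup>2) = c\<^sup>2 * (\<Sum>k\<in>J. p k * (1 - p k)) + (c * m - u)\<^sup>2"
    unfolding expand using S intSS
    by (simp add: exSS prob_space) (simp add: power2_eq_square algebra_simps)
  then show "expectation (\<lambda>\<omega>. (c * (\<Sum>k\<in>J. Z k \<omega>) - u)\<^sup>2)
      = c\<^sup>2 * (\<Sum>k\<in>J. p k * (1 - p k)) + (c * (\<Sum>k\<in>J. p k) - u)\<^sup>2"
    unfolding S_def m_def .
qed

end

section \<open>The mean squared error for a fixed control sequence\<close>

text \<open>\<open>R i\<close> stands for \<open>W i = 1\<close>: position \<open>i\<close> takes
  its pulse from \<open>x\<close>. The disjoint union matches the index set in
  \<open>pulses_indep\<close>, so independence restricts to the selected pulses.\<close>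

definition selected :: "nat \<Rightarrow> (nat \<Rightarrow> bool) \<Rightarrow> (nat + nat) set" where
  "selected N R = {i. i \<in> {1..N} \<and> R i} <+> {i. i \<in> {1..N} \<and> \<not> R i}"

lemma finite_selected: "finite (selected N R)"
  by (auto simp: selected_def)

lemma selected_subset: "selected N R \<subseteq> {1..N} <+> {1..N}"
  by (auto simp: selected_def)

lemma Inl_in_selected_iff: "Inl i \<in> selected N R \<longleftrightarrow> i \<in> {1..N} \<and> R i"
  and Inr_in_selected_iff: "Inr i \<in> selected N R \<longleftrightarrow> i \<in> {1..N} \<and> \<not> R i"
  by (auto simp: selected_def)

lemma sum_selected:
  "sum f (selected N R) = (\<Sum>i | i \<in> {1..N} \<and> R i. f (Inl i)) + (\<Sum>i | i \<in> {1..N} \<and> \<not> R i. f (Inr i))"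
  by (simp add: selected_def sum.Plus)

text \<open>The bias-variance formula for the control sequence given by \<open>R\<close>. It
  mentions no probability space, so it can be studied as a function of \<open>x\<close> and
  \<open>y\<close>.\<close>

definition dither_mse :: "nat \<Rightarrow> real \<Rightarrow> real \<Rightarrow> (nat \<Rightarrow> bool) \<Rightarrow> real" where
  "dither_mse N x y R =
    (let p = case_sum (dither_prob N x) (dither_prob N y) in
      (1 / real N)\<^sup>2 * (\<Sum>k\<in>selected N R. p k * (1 - p k)) +
      ((1 / real N) * (\<Sum>k\<in>selected N R. p k) - (x + y) / 2)\<^sup>2)"

lemma borel_measurable_dither_mse:
  assumes "X \<in> borel_measurable P" and "Y \<in> borel_measurable P"
  shows "(\<lambda>\<omega>. dither_mse N (X \<omega>) (Y \<omega>) R) \<in> borel_measurable P"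
  unfolding dither_mse_def Let_def sum_selected sum.case
  by (intro borel_measurable_add borel_measurable_times borel_measurable_diff borel_measurable_power
      borel_measurable_divide borel_measurable_sum borel_measurable_const assms
      measurable_compose[OF _ borel_measurable_dither_prob])

text \<open>Of the constant 3, the variances contribute 2, namely 1 for each number, and the squared
  bias contributes 1.\<close>

lemma dither_mse_le:
  assumes "N \<ge> 1" and x: "x \<in> {0..1}" and y: "y \<in> {0..1}"
    and R: "R = odd \<or> R = even"
  shows "dither_mse N x y R \<le> 3 / (real N)\<^sup>2"
proof -
  have var: "(\<Sum>i | i \<in> {1..N} \<and> Q i. dither_prob N z i * (1 - dither_prob N z i)) \<le> 1"
    if "z \<in> {0..1}" for Q z
  proof -
    have "(\<Sum>i | i \<in> {1..N} \<and> Q i. dither_prob N z i * (1 - dither_prob N z i))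
        \<le> (\<Sum>i = 1..N. dither_prob N z i * (1 - dither_prob N z i))"
      using dither_prob_nonneg[OF assms(1) that] dither_prob_le_1[OF assms(1) that]
      by (intro sum_mono2) (auto intro!: mult_nonneg_nonneg)
    then show ?thesis using sum_dither_variance[OF assms(1) that] by linarith
  qed
  define alt where "alt z = (\<Sum>i = 1..N. if odd i then dither_prob N z i else - dither_prob N z i)" for z
  have alt: "alt z \<in> {0..1}" if "z \<in> {0..1}" for z
    unfolding alt_def using assms(1) that
    by (intro alternating_sum_antimono dither_prob_nonneg dither_prob_le_1 antimono_dither_prob)
  \<comment> \<open>Exchanging the parities only flips the sign, so one bound on \<open>alt\<close>
    serves both control sequences.\<close>
  have alt': "(\<Sum>i = 1..N. if even i then dither_prob N z i else - dither_prob N z i) = - alt z" for z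
    unfolding alt_def by (subst sum_negf[symmetric]) (intro sum.cong; simp)
  have parity: "(\<Sum>i | i \<in> {1..N} \<and> odd i. dither_prob N z i) = (real N * z + alt z) / 2"
    "(\<Sum>i | i \<in> {1..N} \<and> even i. dither_prob N z i) = (real N * z - alt z) / 2"
    if "z \<in> {0..1}" for z
    unfolding sum_parity sum_dither_prob[OF assms(1) that] alt' by (simp_all add: alt_def)
  have "(\<Sum>i | i \<in> {1..N} \<and> R i. dither_prob N x i) + (\<Sum>i | i \<in> {1..N} \<and> \<not> R i. dither_prob N y i)
      = real N * ((x + y) / 2) + (if R = odd then alt x - alt y else alt y - alt x) / 2"
    using R
  proof
    assume "R = odd"
    then show ?thesis
      by (simp only: parity x y not_not if_True) (simp add: field_simps)
  next
    assume "R = even"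
    moreover from this have "R \<noteq> odd" by (metis even_zero)
    ultimately show ?thesis
      by (simp only: parity x y if_False) (simp add: field_simps)
  qed
  \<comment> \<open>\<open>e\<close> is \<open>N\<close> times the bias. It is half the difference
    of two numbers in the unit interval.\<close>
  then obtain e where e: "\<bar>e\<bar> \<le> 1 / 2" and sum:
    "(\<Sum>i | i \<in> {1..N} \<and> R i. dither_prob N x i) + (\<Sum>i | i \<in> {1..N} \<and> \<not> R i. dither_prob N y i)
      = real N * ((x + y) / 2) + e"
    using alt[OF x] alt[OF y]
    by (intro that[of "(if R = odd then alt x - alt y else alt y - alt x) / 2"]) auto
  have "e\<^sup>2 \<le> 1"
    using e by (simp add: abs_square_le_1)
  have "dither_mse N x y R \<le> (1 / real N)\<^sup>2 * 2 +
      ((1 / real N) * (real N * ((x + y) / 2) + e) - (x + y) / 2)\<^sup>2"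
    unfolding dither_mse_def Let_def sum_selected sum.case sum
    using var[OF x, of R] var[OF y, of "\<lambda>i. \<not> R i"]
    by (intro add_right_mono mult_left_mono) auto
  also have "(1 / real N) * (real N * ((x + y) / 2) + e) - (x + y) / 2 = (1 / real N) * e"
    using assms(1) by (simp add: field_simps)
  also have "(1 / real N)\<^sup>2 * 2 + ((1 / real N) * e)\<^sup>2 = (1 / real N)\<^sup>2 * (2 + e\<^sup>2)"
    by (simp only: power_mult_distrib distrib_left)
  also have "\<dots> \<le> (1 / real N)\<^sup>2 * 3"
    using \<open>e\<^sup>2 \<le> 1\<close> by (intro mult_left_mono) auto
  finally show ?thesis
    by (simp add: power_divide)
qed

section \<open>Conditioning on the control sequence\<close>

context dither_computing
begin

text \<open>What \<open>U_avg\<close> becomes once the control sequence is known. It depends on the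
  pulses alone and is thus independent of the control sequence.\<close>

definition pulse_avg :: "(nat \<Rightarrow> bool) \<Rightarrow> 'a \<Rightarrow> real" where
  "pulse_avg R \<omega> = (1 / real N) * (\<Sum>k\<in>selected N R. case_sum A B k \<omega>)"

lemma U_avg_eq_pulse_avg:
  assumes "\<forall>i\<in>{1..N}. W i \<omega> = (if R i then 1 else 0)"
  shows "U_avg N A B W \<omega> = pulse_avg R \<omega>"
proof -
  have "(\<Sum>i = 1..N. W i \<omega> * A i \<omega> + (1 - W i \<omega>) * B i \<omega>)
      = (\<Sum>i = 1..N. (if R i then A i \<omega> else 0) + (if \<not> R i then B i \<omega> else 0))"
    using assms by (intro sum.cong) auto
  also have "\<dots> = (\<Sum>k\<in>selected N R. case_sum A B k \<omega>)"
    by (simp only: sum_selected sum.distrib sum.inter_filter finite_atLeastAtMost sum.case)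
  finally show ?thesis
    by (simp add: U_avg_def pulse_avg_def)
qed

lemma pulse_avg_moments:
  shows "integrable M (pulse_avg R)"
    and "expectation (pulse_avg R) = (1 / real N) *
      (\<Sum>k\<in>selected N R. case_sum (dither_prob N x) (dither_prob N y) k)"
    and "integrable M (\<lambda>\<omega>. (pulse_avg R \<omega> - (x + y) / 2)\<^sup>2)"
    and "expectation (\<lambda>\<omega>. (pulse_avg R \<omega> - (x + y) / 2)\<^sup>2) = dither_mse N x y R"
proof -
  have indep: "indep_vars (\<lambda>_. borel) (case_sum A B) (selected N R)"
    using pulses_indep selected_subset by (rule indep_vars_subset)
  have bit: "case_sum A B k \<omega> \<in> {0, 1}" if "k \<in> selected N R" "\<omega> \<in> space M" for k \<omega>
    using that A_bit[of _ \<omega>] B_bit[of _ \<omega>]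
    by (cases k) (simp_all add: Inl_in_selected_iff Inr_in_selected_iff)
  have p: "prob {\<omega> \<in> space M. case_sum A B k \<omega> = 1} = case_sum (dither_prob N x) (dither_prob N y) k"
    if "k \<in> selected N R" for k
    using that A_prob B_prob
    by (cases k) (simp_all add: Inl_in_selected_iff Inr_in_selected_iff)
  note * = indep_bits_mse[OF finite_selected indep bit p]
  show "integrable M (pulse_avg R)"
    and "expectation (pulse_avg R) = (1 / real N) *
      (\<Sum>k\<in>selected N R. case_sum (dither_prob N x) (dither_prob N y) k)"
    and "integrable M (\<lambda>\<omega>. (pulse_avg R \<omega> - (x + y) / 2)\<^sup>2)"
    and "expectation (\<lambda>\<omega>. (pulse_avg R \<omega> - (x + y) / 2)\<^sup>2) = dither_mse N x y R"
    unfolding pulse_avg_def[abs_def] dither_mse_def Let_def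
    by (rule *; assumption)+
qed

text \<open>The law of total expectation over the two control sequences. The function
  \<open>h\<close> is kept general to serve both the mean and the mean squared error.\<close>

lemma expectation_U_avg_split:
  fixes h :: "real \<Rightarrow> real"
  assumes "N \<ge> 1" and h [measurable]: "h \<in> borel_measurable borel"
    and int: "\<And>R. integrable M (\<lambda>\<omega>. h (pulse_avg R \<omega>))"
  shows "expectation (\<lambda>\<omega>. h (U_avg N A B W \<omega>)) =
    (expectation (\<lambda>\<omega>. h (pulse_avg odd \<omega>)) + expectation (\<lambda>\<omega>. h (pulse_avg even \<omega>))) / 2"
proof -
  let ?F = "vimage_algebra (space M) (\<lambda>\<omega>. \<lambda>i\<in>{1..N}. W i \<omega>) (PiM {1..N} (\<lambda>_. borel))"
  let ?G = "vimage_algebra (space M) (\<lambda>\<omega>. \<lambda>k\<in>{1..N} <+> {1..N}. case_sum A B k \<omega>)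
    (PiM ({1..N} <+> {1..N}) (\<lambda>_. borel))"
  define E where "E R = {\<omega> \<in> space M. \<forall>i\<in>{1..N}. W i \<omega> = (if R i then 1 else 0)}" for R
  have W: "W i \<in> borel_measurable ?F" if "i \<in> {1..N}" for i
  proof -
    have "(\<lambda>\<omega>. (\<lambda>i\<in>{1..N}. W i \<omega>) i) \<in> borel_measurable ?F"
      using that by (intro measurable_compose[OF measurable_vimage_algebra1 measurable_component_singleton])
        (auto simp: space_PiM)
    then show ?thesis using that by simp
  qed
  have EF: "E R \<in> sets ?F" for R
  proof -
    have "{\<omega> \<in> space ?F. \<forall>i\<in>{1..N}. W i \<omega> = (if R i then 1 else 0)} \<in> sets ?F"
      using assms(1) by (intro sets.sets_Collect_finite_All' measurable_sets_Collect[OF W]) auto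
    then show ?thesis by (simp add: E_def)
  qed
  have EM: "E R \<in> events" for R
    using EF indep_setD_ev1[OF W_indep] by blast
  have pulse: "case_sum A B k \<in> borel_measurable ?G" if "k \<in> {1..N} <+> {1..N}" for k
  proof -
    have "(\<lambda>\<omega>. (\<lambda>k\<in>{1..N} <+> {1..N}. case_sum A B k \<omega>) k) \<in> borel_measurable ?G"
      using that by (intro measurable_compose[OF measurable_vimage_algebra1 measurable_component_singleton])
        (auto simp: space_PiM)
    then show ?thesis using that by simp
  qed
  have "pulse_avg R \<in> borel_measurable ?G" for R
    unfolding pulse_avg_def[abs_def] using pulse selected_subset[of N R]
    by (intro borel_measurable_times borel_measurable_sum borel_measurable_const) blast
  then have hG: "(\<lambda>\<omega>. h (pulse_avg R \<omega>)) \<in> borel_measurable ?G" for R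
    by measurable
  have split: "integrable M (\<lambda>\<omega>. indicator (E Q) \<omega> * h (pulse_avg R \<omega>))"
    "expectation (\<lambda>\<omega>. indicator (E Q) \<omega> * h (pulse_avg R \<omega>))
      = prob (E Q) * expectation (\<lambda>\<omega>. h (pulse_avg R \<omega>))" for Q R
    using expectation_indicator_mult_indep[OF W_indep _ _ EF hG int] by simp_all
  have "E odd = {\<omega> \<in> space M. \<forall>i\<in>{1..N}. W i \<omega> = alternating i}"
    "E even = {\<omega> \<in> space M. \<forall>i\<in>{1..N}. W i \<omega> = 1 - alternating i}"
    unfolding E_def alternating_def by (auto split: if_splits)
  then have half: "prob (E odd) = 1/2" "prob (E even) = 1/2"
    using W_prob W_prob' by simp_all
  \<comment> \<open>The two control sequences already differ at index 1, which is present because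
    \<open>N \<ge> 1\<close>.\<close>
  have disj: "E odd \<inter> E even = {}"
    using assms(1) by (auto simp: E_def intro!: bexI[of _ 1])
  \<comment> \<open>The two events exhaust the probability, so the behaviour of \<open>W\<close>
    outside them is confined to a null set.\<close>
  have "prob (E odd \<union> E even) = 1"
    using half by (simp add: finite_measure_Union[OF EM EM disj])
  then have "AE \<omega> in M. \<omega> \<in> E odd \<union> E even"
    using EM by (subst (asm) prob_eq_1) auto
  then have "AE \<omega> in M. h (U_avg N A B W \<omega>) =
      indicator (E odd) \<omega> * h (pulse_avg odd \<omega>) + indicator (E even) \<omega> * h (pulse_avg even \<omega>)"
  proof eventually_elim
    case (elim \<omega>)
    then show ?case
      using disj U_avg_eq_pulse_avg[of \<omega> odd] U_avg_eq_pulse_avg[of \<omega> even]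
      by (auto simp: indicator_def) (auto simp: E_def)
  qed
  \<comment> \<open>Passing from almost everywhere equality to equal expectations uses measurability
    of both sides; for the pulses it is part of \<open>pulses_indep\<close>.\<close>
  moreover have "random_variable borel (A i)" "random_variable borel (B i)" if "i \<in> {1..N}" for i
    using pulses_indep[unfolded indep_vars_def, THEN conjunct1, THEN bspec, OF InlI[OF that]]
      pulses_indep[unfolded indep_vars_def, THEN conjunct1, THEN bspec, OF InrI[OF that]] by simp_all
  then have "(\<lambda>\<omega>. U_avg N A B W \<omega>) \<in> borel_measurable M"
    unfolding U_avg_def[abs_def] using W_rv
    by (intro borel_measurable_times borel_measurable_sum borel_measurable_add
        borel_measurable_diff borel_measurable_const) auto
  ultimately have "expectation (\<lambda>\<omega>. h (U_avg N A B W \<omega>)) = expectation (\<lambda>\<omega>.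
      indicator (E odd) \<omega> * h (pulse_avg odd \<omega>) + indicator (E even) \<omega> * h (pulse_avg even \<omega>))"
    using split(1)
    by (intro integral_cong_AE) (auto intro!: borel_measurable_add borel_measurable_integrable)
  also have "\<dots> = expectation (\<lambda>\<omega>. indicator (E odd) \<omega> * h (pulse_avg odd \<omega>)) +
      expectation (\<lambda>\<omega>. indicator (E even) \<omega> * h (pulse_avg even \<omega>))"
    by (rule Bochner_Integration.integral_add[OF split(1) split(1)])
  finally show ?thesis
    by (simp only: split(2) half) (simp add: field_simps)
qed

text \<open>Over the two control sequences together, every position is taken once from
  \<open>x\<close> and once from \<open>y\<close>. The parity sums therefore recombine into the full
  sums \<open>N * x\<close> and \<open>N * y\<close>.\<close>

lemma expectation_U_avg:
  assumes "N \<ge> 1" and "x \<in> {0..1}" and "y \<in> {0..1}"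
  shows "expectation (U_avg N A B W) = (x + y) / 2"
proof -
  have sum: "(\<Sum>i | i \<in> {1..N} \<and> odd i. f i) + (\<Sum>i | i \<in> {1..N} \<and> even i. f i) = (\<Sum>i = 1..N. f i)"
    for f :: "nat \<Rightarrow> real"
    by (subst sum.union_disjoint[symmetric]) (auto intro: sum.cong)
  have "expectation (U_avg N A B W) = (expectation (pulse_avg odd) + expectation (pulse_avg even)) / 2"
    using expectation_U_avg_split[of "\<lambda>z. z"] assms(1) pulse_avg_moments(1) by simp
  also have "\<dots> = (1 / real N) * ((\<Sum>i = 1..N. dither_prob N x i) + (\<Sum>i = 1..N. dither_prob N y i)) / 2"
    by (simp only: pulse_avg_moments(2) sum_selected sum.case not_not flip: sum distrib_left)
       (simp add: algebra_simps)
  also have "\<dots> = (x + y) / 2"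
    unfolding sum_dither_prob[OF assms(1,2)] sum_dither_prob[OF assms(1,3)]
    using assms(1) by (simp add: field_simps)
  finally show ?thesis .
qed

text \<open>Shows that the error is determined by \<open>N\<close>, \<open>x\<close> and
  \<open>y\<close>, whatever space carries the pulses.\<close>

lemma cond_mse_eq:
  assumes "N \<ge> 1"
  shows "cond_mse M N x y A B W = (dither_mse N x y odd + dither_mse N x y even) / 2"
  unfolding cond_mse_def
  using expectation_U_avg_split[of "\<lambda>z. (z - (x + y) / 2)\<^sup>2"] assms pulse_avg_moments(3,4)
  by simp

lemma cond_mse_le:
  assumes "N \<ge> 1" and "x \<in> {0..1}" and "y \<in> {0..1}"
  shows "cond_mse M N x y A B W \<le> 3 / (real N)\<^sup>2"
  using dither_mse_le[OF assms, of odd] dither_mse_le[OF assms, of even]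
  by (simp add: cond_mse_eq[OF assms(1)])

text \<open>The bias vanishes, so deviations from the mean are deviations from
  \<open>(x + y) / 2\<close>.\<close>

lemma variance_U_avg:
  assumes "N \<ge> 1" and "x \<in> {0..1}" and "y \<in> {0..1}"
  shows "variance (U_avg N A B W) = cond_mse M N x y A B W"
  by (simp add: expectation_U_avg[OF assms] cond_mse_def)

end

section \<open>Asymptotics and averaging over the samples\<close>

lemma bigo_inverse_square:
  assumes "\<And>N. N \<ge> 1 \<Longrightarrow> 0 \<le> f N" and "\<And>N. N \<ge> 1 \<Longrightarrow> f N \<le> C / (real N)\<^sup>2"
  shows "f \<in> O(\<lambda>N. 1 / (real N)\<^sup>2)"
proof (rule bigoI)
  show "\<forall>\<^sub>F N in sequentially. norm (f N) \<le> C * norm (1 / (real N)\<^sup>2)"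
    using eventually_ge_at_top[of 1]
  proof eventually_elim
    case (elim N)
    then show ?case using assms[of N] by simp
  qed
qed

text \<open>The uniform constant in the third conjunct is what survives averaging over
  \<open>X\<close> and \<open>Y\<close>. The integrability conjunct guarantees that the last
  expectation is a genuine integral and not the default value 0.\<close>

theorem mainTheorem2:
  fixes M :: "nat \<Rightarrow> real \<Rightarrow> real \<Rightarrow> 'a measure"
    and A B W :: "nat \<Rightarrow> real \<Rightarrow> real \<Rightarrow> nat \<Rightarrow> 'a \<Rightarrow> real"
    and P :: "'b measure" and X Y :: "'b \<Rightarrow> real"
  assumes dither: "\<And>N x y. N \<ge> 1 \<Longrightarrow> x \<in> {0..1} \<Longrightarrow> y \<in> {0..1} \<Longrightarrow>
      dither_computing (M N x y) N x y (A N x y) (B N x y) (W N x y)"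
    and P: "prob_space P"
    and XY_indep: "prob_space.indep_var P borel X borel Y"
    and X_range: "\<And>\<omega>. \<omega> \<in> space P \<Longrightarrow> X \<omega> \<in> {0..1}"
    and Y_range: "\<And>\<omega>. \<omega> \<in> space P \<Longrightarrow> Y \<omega> \<in> {0..1}"
  shows
    "(\<forall>N\<ge>1. \<forall>x\<in>{0..1}. \<forall>y\<in>{0..1}.
        prob_space.expectation (M N x y) (U_avg N (A N x y) (B N x y) (W N x y)) = (x + y) / 2) \<and>
     (\<forall>x\<in>{0..1}. \<forall>y\<in>{0..1}.
        (\<lambda>N. prob_space.variance (M N x y) (U_avg N (A N x y) (B N x y) (W N x y)))
          \<in> O(\<lambda>N. 1 / (real N)\<^sup>2)) \<and>
     (\<exists>C. \<forall>N\<ge>1. \<forall>x\<in>{0..1}. \<forall>y\<in>{0..1}.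
        prob_space.variance (M N x y) (U_avg N (A N x y) (B N x y) (W N x y))
          \<le> C / (real N)\<^sup>2) \<and>
     (\<forall>N\<ge>1. integrable P (\<lambda>\<omega>. cond_mse (M N (X \<omega>) (Y \<omega>)) N (X \<omega>) (Y \<omega>)
        (A N (X \<omega>) (Y \<omega>)) (B N (X \<omega>) (Y \<omega>)) (W N (X \<omega>) (Y \<omega>)))) \<and>
     (\<lambda>N. prob_space.expectation P (\<lambda>\<omega>. cond_mse (M N (X \<omega>) (Y \<omega>)) N (X \<omega>) (Y \<omega>)
        (A N (X \<omega>) (Y \<omega>)) (B N (X \<omega>) (Y \<omega>)) (W N (X \<omega>) (Y \<omega>))))
       \<in> O(\<lambda>N. 1 / (real N)\<^sup>2)"
proof (intro conjI allI ballI impI)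
  show "prob_space.expectation (M N x y) (U_avg N (A N x y) (B N x y) (W N x y)) = (x + y) / 2"
    if "N \<ge> 1" "x \<in> {0..1}" "y \<in> {0..1}" for N x y
    using dither_computing.expectation_U_avg[OF dither] that by blast
  have var: "0 \<le> prob_space.variance (M N x y) (U_avg N (A N x y) (B N x y) (W N x y))"
    for N x y
    by simp
  have var': "prob_space.variance (M N x y) (U_avg N (A N x y) (B N x y) (W N x y)) \<le> 3 / (real N)\<^sup>2"
    if "N \<ge> 1" "x \<in> {0..1}" "y \<in> {0..1}" for N x y
    using dither_computing.variance_U_avg[OF dither[OF that] that]
      dither_computing.cond_mse_le[OF dither[OF that] that] by simp
  then show "\<exists>C. \<forall>N\<ge>1. \<forall>x\<in>{0..1}. \<forall>y\<in>{0..1}.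
      prob_space.variance (M N x y) (U_avg N (A N x y) (B N x y) (W N x y)) \<le> C / (real N)\<^sup>2"
    by blast
  show "(\<lambda>N. prob_space.variance (M N x y) (U_avg N (A N x y) (B N x y) (W N x y)))
      \<in> O(\<lambda>N. 1 / (real N)\<^sup>2)" if "x \<in> {0..1}" "y \<in> {0..1}" for x y
    using that by (intro bigo_inverse_square[of _ 3] var var')
  interpret P: prob_space P by fact
  let ?L = "\<lambda>N \<omega>. cond_mse (M N (X \<omega>) (Y \<omega>)) N (X \<omega>) (Y \<omega>)
    (A N (X \<omega>) (Y \<omega>)) (B N (X \<omega>) (Y \<omega>)) (W N (X \<omega>) (Y \<omega>))"
  let ?D = "\<lambda>N \<omega>. (dither_mse N (X \<omega>) (Y \<omega>) odd + dither_mse N (X \<omega>) (Y \<omega>) even) / 2"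
  have rv: "X \<in> borel_measurable P" "Y \<in> borel_measurable P"
    using XY_indep unfolding P.indep_var_eq by simp_all
  have L: "?L N \<omega> = ?D N \<omega>" "0 \<le> ?L N \<omega>" "?L N \<omega> \<le> 3 / (real N)\<^sup>2"
    if "N \<ge> 1" "\<omega> \<in> space P" for N \<omega>
    using dither_computing.cond_mse_eq[OF dither that(1)] dither_computing.cond_mse_le[OF dither that(1)]
      X_range Y_range that by (simp_all add: cond_mse_def)
  show int: "integrable P (?L N)" if "N \<ge> 1" for N
  proof (rule P.integrable_const_bound)
    show "AE \<omega> in P. norm (?L N \<omega>) \<le> 3 / (real N)\<^sup>2"
      using L that by (intro AE_I2) simp
    \<comment> \<open>The spaces \<open>M N x y\<close> may vary arbitrarily with the sample, so
      measurability is obtained from the explicit formula, which agrees with the error on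
      \<open>space P\<close>.\<close>
    have "?D N \<in> borel_measurable P"
      by (intro borel_measurable_divide borel_measurable_add borel_measurable_dither_mse
          borel_measurable_const rv)
    then show "?L N \<in> borel_measurable P"
      by (subst measurable_cong[OF L(1)[OF that]])
  qed
  show "(\<lambda>N. P.expectation (?L N)) \<in> O(\<lambda>N. 1 / (real N)\<^sup>2)"
    using L int by (intro bigo_inverse_square[of _ 3])
      (auto intro!: Bochner_Integration.integral_nonneg P.integral_le_const)
qed

end
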